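(* Let $f,g,h$ be twice continuously differentiable, let $(x^*,y^* )$ be an M-stationary point of the reformulation (R) satisfying CC-CPLD, and let $$d_x^T\left(\nabla^2f(x^* )+\sum_{i=1}^m\lambda_i\nabla^2g_i(x^* )+\sum_{i=1}^p\mu_i\nabla^2h_i(x^* )\right)d_x>0$$ hold for all $(d_x,d_y)\in\mathcal{C}^{CC}_Z(x^*,y^* )$ with $d_x\neq0$ and all M-stationary multipliers $(\lambda,\mu,\gamma)$ of $(x^*,y^* )$. Then there exists a radius $r>0$ such that for all $(x,y)\in Z\cap B_r(x^*,y^* )$: if $(x,y)$ is M-stationary, then $x=x^*$.
   Context: Setting. $f:\mathbb{R}^n\to\mathbb{R}$, $g:\mathbb{R}^n\to\mathbb{R}^m$, $h:\mathbb{R}^n\to\mathbb{R}^p$ are continuously differentiable, $\kappa<n$ is an integer, $X=\{x\in\mathbb{R}^n\mid g(x)\le 0,\ h(x)=0\}$, $\|x\|_0$ is the number of nonzero components of $x$, and $\{x\in X\mid \|x\|_0\le\kappa\}\neq\emptyset$. The reformulation (R) is: minimize $f(x)$ over $(x,y)\in\mathbb{R}^n\times\mathbb{R}^n$ subject to $g(x)\le0$, $h(x)=0$, $0\le y\le e$, $e^Ty\ge n-\kappa$, $x\circ y=0$, where $e$ is the all-ones vector and $\circ$ is the componentwise product. $Z$ denotes the feasible set of (R). $e_i$ denotes the $i$-th unit vector and $B_r(\cdot)$ an open ball of radius $r$ with respect to an arbitrary norm. Index sets for $(x^*,y^* )\in Z$: $I_g=I_g(x^* )=\{i\mid g_i(x^*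 )=0\}$, $I_0=I_0(x^* )=\{i\mid x_i^*=0\}$, $I_{\pm0}=\{i\mid x_i^*\ne0,\ y_i^*=0\}$, $I_{00}=\{i\mid x_i^*=0,\ y_i^*=0\}$, $I_{0+}=\{i\mid x_i^*=0,\ y_i^*\in(0,1)\}$, $I_{01}=\{i\mid x_i^*=0,\ y_i^*=1\}$. M-stationarity: $(x^*,y^* )\in Z$ is M-stationary if there is an M-stationary multiplier $(\lambda,\mu,\gamma)\in\mathbb{R}^m\times\mathbb{R}^p\times\mathbb{R}^n$, i.e. one with $\nabla f(x^* )+\sum_{i=1}^m\lambda_i\nabla g_i(x^* )+\sum_{i=1}^p\mu_i\nabla h_i(x^* )+\sum_{i=1}^n\gamma_ie_i=0$, $\lambda_i\ge0$ and $\lambda_ig_i(x^* )=0$ for all $i=1,\dots,m$, and $\gamma_i=0$ for all $i\in I_{\pm0}$. Vectors $a_i$ ($i\in A$) and $b_j$ ($j\in B$) are positively linearly dependent if there are $\lambda_i\ge0$ ($i\in A$) and $\mu_j\in\mathbb{R}$ ($j\in B$), not all zero, with $\sum_{i\in A}\lambda_ia_i+\sum_{j\in B}\mu_jb_j=0$. CC-CPLD holds at $(x^*,y^* )$ if for all subsets $I_1\subseteq I_g(x^* )$, $I_2\subseteq\{1,\dots,p\}$, $I_3\subseteq I_0(x^* )$ such that the vectors $\nabla g_i(x)$ ($i\in I_1$), in the role of the $a_i$, and $\nabla h_i(x)$ ($i\in I_2$), $e_i$ ($i\in I_3$), in the role of the $b_j$, are positively linearly dependent at $x=x^*$, these vectors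 remain linearly dependent for all $x$ in a neighbourhood of $x^*$. CC-linearisation cone: $\mathcal{L}^{CC}_Z(x^*,y^* )$ is the set of all $(d_x,d_y)\in\mathbb{R}^n\times\mathbb{R}^n$ with $\nabla g_i(x^* )^Td_x\le0$ for $i\in I_g$; $\nabla h_i(x^* )^Td_x=0$ for $i=1,\dots,p$; $e^Td_y\ge0$ if $e^Ty^*=n-\kappa$; $e_i^Td_y=0$ for $i\in I_{\pm0}$; $e_i^Td_y\ge0$ for $i\in I_{00}$; $e_i^Td_y\le0$ for $i\in I_{01}$; $e_i^Td_x=0$ for $i\in I_{01}\cup I_{0+}$; $(e_i^Td_x)(e_i^Td_y)=0$ for $i\in I_{00}$. CC-critical cone: $\mathcal{C}^{CC}_Z(x^*,y^* )=\{(d_x,d_y)\in\mathcal{L}^{CC}_Z(x^*,y^* )\mid\nabla f(x^* )^Td_x\le0\}$. *)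

theory Defs
  imports "HOL-Analysis.Analysis"
begin

text \<open>
  The constraints are families \<open>g 1, \<dots>, g m\<close> and \<open>h 1, \<dots>, h p\<close> of real functions indexed by
  natural numbers, so that \<open>m = 0\<close> and \<open>p = 0\<close> are allowed; values of \<open>g\<close>, \<open>h\<close> and of
  multipliers outside these index ranges are never used.
\<close>

definition grad :: "(real ^ 'n \<Rightarrow> real) \<Rightarrow> real ^ 'n \<Rightarrow> real ^ 'n" where
  "grad f x = (\<chi> i. frechet_derivative f (at x) (axis i 1))"

definition hessian :: "(real ^ 'n \<Rightarrow> real) \<Rightarrow> real ^ 'n \<Rightarrow> real ^ 'n ^ 'n" where
  "hessian f x = jacobian (grad f) (at x)"

definition twice_cont_diff :: "(real ^ 'n \<Rightarrow> real) \<Rightarrow> bool" where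
  "twice_cont_diff f \<longleftrightarrow>
     (\<forall>x. f differentiable (at x)) \<and> (\<forall>x. grad f differentiable (at x)) \<and>
     continuous_on UNIV (hessian f)"

lemma GDERIV_grad:
  assumes "f differentiable (at x)"
  shows "GDERIV f x :> grad f x"
proof -
  let ?D = "frechet_derivative f (at x)"
  have D: "(f has_derivative ?D) (at x)"
    using assms by (simp add: frechet_derivative_works)
  then have lin: "linear ?D"
    by (rule has_derivative_linear)
  have "?D v = v \<bullet> grad f x" for v
  proof -
    have "?D v = ?D (\<Sum>i\<in>UNIV. v $ i *\<^sub>R axis i 1)"
      by (simp add: basis_expansion flip: scalar_mult_eq_scaleR)
    also have "\<dots> = (\<Sum>i\<in>UNIV. v $ i * ?D (axis i 1))"
      using lin by (simp add: linear_sum linear_scale)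
    finally show ?thesis
      by (simp add: inner_vec_def grad_def)
  qed
  with D show ?thesis
    unfolding gderiv_def by (metis (no_types, lifting) ext)
qed

lemma hessian_has_derivative:
  assumes "twice_cont_diff f"
  shows "(grad f has_derivative (\<lambda>d. hessian f x *v d)) (at x)"
  using assms unfolding twice_cont_diff_def hessian_def
  by (simp add: jacobian_works[symmetric])

definition is_norm :: "('a::real_vector \<Rightarrow> real) \<Rightarrow> bool" where
  "is_norm N \<longleftrightarrow>
     (\<forall>v. 0 \<le> N v) \<and> (\<forall>v. N v = 0 \<longleftrightarrow> v = 0) \<and>
     (\<forall>c v. N (c *\<^sub>R v) = \<bar>c\<bar> * N v) \<and> (\<forall>v w. N (v + w) \<le> N v + N w)"

definition l0 :: "real ^ 'n \<Rightarrow> nat" where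
  "l0 x = card {i. x $ i \<noteq> 0}"

definition feasX ::
  "nat \<Rightarrow> nat \<Rightarrow> (nat \<Rightarrow> real ^ 'n \<Rightarrow> real) \<Rightarrow> (nat \<Rightarrow> real ^ 'n \<Rightarrow> real) \<Rightarrow> (real ^ 'n) set" where
  "feasX m p g h = {x. (\<forall>i\<in>{1..m}. g i x \<le> 0) \<and> (\<forall>i\<in>{1..p}. h i x = 0)}"

definition feasZ ::
  "nat \<Rightarrow> nat \<Rightarrow> int \<Rightarrow> (nat \<Rightarrow> real ^ 'n \<Rightarrow> real) \<Rightarrow> (nat \<Rightarrow> real ^ 'n \<Rightarrow> real) \<Rightarrow>
    ((real ^ 'n) \<times> (real ^ 'n)) set" where
  "feasZ m p \<kappa> g h =
     {(x, y). (\<forall>i\<in>{1..m}. g i x \<le> 0) \<and> (\<forall>i\<in>{1..p}. h i x = 0) \<and>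
        (\<forall>i. 0 \<le> y $ i \<and> y $ i \<le> 1) \<and>
        (\<Sum>i\<in>UNIV. y $ i) \<ge> real CARD('n) - real_of_int \<kappa> \<and>
        (\<forall>i. x $ i * y $ i = 0)}"

definition I_g :: "nat \<Rightarrow> (nat \<Rightarrow> real ^ 'n \<Rightarrow> real) \<Rightarrow> real ^ 'n \<Rightarrow> nat set" where
  "I_g m g x = {i\<in>{1..m}. g i x = 0}"

definition I_0 :: "real ^ 'n \<Rightarrow> 'n set" where
  "I_0 x = {i. x $ i = 0}"

definition I_pm0 :: "real ^ 'n \<Rightarrow> real ^ 'n \<Rightarrow> 'n set" where
  "I_pm0 x y = {i. x $ i \<noteq> 0 \<and> y $ i = 0}"

definition I_00 :: "real ^ 'n \<Rightarrow> real ^ 'n \<Rightarrow> 'n set" where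
  "I_00 x y = {i. x $ i = 0 \<and> y $ i = 0}"

definition I_0p :: "real ^ 'n \<Rightarrow> real ^ 'n \<Rightarrow> 'n set" where
  "I_0p x y = {i. x $ i = 0 \<and> 0 < y $ i \<and> y $ i < 1}"

definition I_01 :: "real ^ 'n \<Rightarrow> real ^ 'n \<Rightarrow> 'n set" where
  "I_01 x y = {i. x $ i = 0 \<and> y $ i = 1}"

definition M_multiplier ::
  "nat \<Rightarrow> nat \<Rightarrow> (real ^ 'n \<Rightarrow> real) \<Rightarrow> (nat \<Rightarrow> real ^ 'n \<Rightarrow> real) \<Rightarrow> (nat \<Rightarrow> real ^ 'n \<Rightarrow> real) \<Rightarrow>
    real ^ 'n \<Rightarrow> real ^ 'n \<Rightarrow> (nat \<Rightarrow> real) \<Rightarrow> (nat \<Rightarrow> real) \<Rightarrow> real ^ 'n \<Rightarrow> bool" where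
  "M_multiplier m p f g h x y lam mu gam \<longleftrightarrow>
     grad f x + (\<Sum>i=1..m. lam i *\<^sub>R grad (g i) x) + (\<Sum>i=1..p. mu i *\<^sub>R grad (h i) x)
       + (\<Sum>i\<in>UNIV. gam $ i *\<^sub>R axis i 1) = 0 \<and>
     (\<forall>i\<in>{1..m}. lam i \<ge> 0 \<and> lam i * g i x = 0) \<and>
     (\<forall>i\<in>I_pm0 x y. gam $ i = 0)"

definition M_stationary ::
  "nat \<Rightarrow> nat \<Rightarrow> int \<Rightarrow> (real ^ 'n \<Rightarrow> real) \<Rightarrow> (nat \<Rightarrow> real ^ 'n \<Rightarrow> real) \<Rightarrow>
    (nat \<Rightarrow> real ^ 'n \<Rightarrow> real) \<Rightarrow> real ^ 'n \<Rightarrow> real ^ 'n \<Rightarrow> bool" where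
  "M_stationary m p \<kappa> f g h x y \<longleftrightarrow>
     (x, y) \<in> feasZ m p \<kappa> g h \<and> (\<exists>lam mu gam. M_multiplier m p f g h x y lam mu gam)"

text \<open>
  (Positive) linear dependence refers to indexed families rather than to sets of vectors
  (a repeated vector makes the family dependent), hence the library constant \<open>dependent\<close>,
  which is about sets, is not used.  A family consisting of several groups of vectors is
  indexed by a disjoint sum.
\<close>

definition pos_lin_dep ::
  "'i set \<Rightarrow> ('i \<Rightarrow> 'v::real_vector) \<Rightarrow> 'j set \<Rightarrow> ('j \<Rightarrow> 'v) \<Rightarrow> bool" where
  "pos_lin_dep A a B b \<longleftrightarrow>
     (\<exists>lam mu. (\<forall>i\<in>A. lam i \<ge> 0) \<and> ((\<exists>i\<in>A. lam i \<noteq> 0) \<or> (\<exists>j\<in>B. mu j \<noteq> 0)) \<and>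
        (\<Sum>i\<in>A. lam i *\<^sub>R a i) + (\<Sum>j\<in>B. mu j *\<^sub>R b j) = 0)"

definition lin_dep :: "'i set \<Rightarrow> ('i \<Rightarrow> 'v::real_vector) \<Rightarrow> bool" where
  "lin_dep A a \<longleftrightarrow> (\<exists>c. (\<exists>i\<in>A. c i \<noteq> 0) \<and> (\<Sum>i\<in>A. c i *\<^sub>R a i) = 0)"

definition CC_CPLD ::
  "nat \<Rightarrow> nat \<Rightarrow> (nat \<Rightarrow> real ^ 'n \<Rightarrow> real) \<Rightarrow> (nat \<Rightarrow> real ^ 'n \<Rightarrow> real) \<Rightarrow> real ^ 'n \<Rightarrow> bool" where
  "CC_CPLD m p g h x \<longleftrightarrow>
     (\<forall>I1 I2 I3. I1 \<subseteq> I_g m g x \<longrightarrow> I2 \<subseteq> {1..p} \<longrightarrow> I3 \<subseteq> I_0 x \<longrightarrow>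
        pos_lin_dep I1 (\<lambda>i. grad (g i) x)
          (I2 <+> I3) (case_sum (\<lambda>i. grad (h i) x) (\<lambda>i. axis i 1)) \<longrightarrow>
        (\<forall>\<^sub>F z in nhds x.
           lin_dep (I1 <+> (I2 <+> I3))
             (case_sum (\<lambda>i. grad (g i) z)
               (case_sum (\<lambda>i. grad (h i) z) (\<lambda>i. axis i 1)))))"

definition CC_lin_cone ::
  "nat \<Rightarrow> nat \<Rightarrow> int \<Rightarrow> (nat \<Rightarrow> real ^ 'n \<Rightarrow> real) \<Rightarrow> (nat \<Rightarrow> real ^ 'n \<Rightarrow> real) \<Rightarrow>
    real ^ 'n \<Rightarrow> real ^ 'n \<Rightarrow> ((real ^ 'n) \<times> (real ^ 'n)) set" where
  "CC_lin_cone m p \<kappa> g h x y =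
     {(dx, dy).
        (\<forall>i\<in>I_g m g x. grad (g i) x \<bullet> dx \<le> 0) \<and>
        (\<forall>i\<in>{1..p}. grad (h i) x \<bullet> dx = 0) \<and>
        ((\<Sum>i\<in>UNIV. y $ i) = real CARD('n) - real_of_int \<kappa> \<longrightarrow> (\<Sum>i\<in>UNIV. dy $ i) \<ge> 0) \<and>
        (\<forall>i\<in>I_pm0 x y. dy $ i = 0) \<and>
        (\<forall>i\<in>I_00 x y. dy $ i \<ge> 0) \<and>
        (\<forall>i\<in>I_01 x y. dy $ i \<le> 0) \<and>
        (\<forall>i\<in>I_01 x y \<union> I_0p x y. dx $ i = 0) \<and>
        (\<forall>i\<in>I_00 x y. dx $ i * dy $ i = 0)}"

definition CC_crit_cone ::
  "nat \<Rightarrow> nat \<Rightarrow> int \<Rightarrow> (real ^ 'n \<Rightarrow> real) \<Rightarrow> (nat \<Rightarrow> real ^ 'n \<Rightarrow> real) \<Rightarrow>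
    (nat \<Rightarrow> real ^ 'n \<Rightarrow> real) \<Rightarrow> real ^ 'n \<Rightarrow> real ^ 'n \<Rightarrow> ((real ^ 'n) \<times> (real ^ 'n)) set" where
  "CC_crit_cone m p \<kappa> f g h x y =
     {(dx, dy) \<in> CC_lin_cone m p \<kappa> g h x y. grad f x \<bullet> dx \<le> 0}"

end

theory Submission
  imports Defs
begin

text \<open>
  Suppose that M-stationary points \<open>(x\<^sub>k, y\<^sub>k)\<close> with \<open>x\<^sub>k \<noteq> x\<^sup>*\<close> converge to \<open>(x\<^sup>*, y\<^sup>*)\<close>.
  The contradiction comes from a direction \<open>d\<close>, a limit of
  \<open>(x\<^sub>k - x\<^sup>*) / \<parallel>x\<^sub>k - x\<^sup>*\<parallel>\<close>, that is critical but along which the Hessian of the Lagrangian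
  vanishes as a quadratic form.

  For a feasible point, M-stationarity only involves \<open>x\<close>: it is the stationarity of \<open>x\<close> for
  the constraints \<open>g i\<close>, \<open>h i\<close> and the coordinate functions \<open>x $ i\<close>, each multiplier
  being complementary to its constraint.  All three kinds of constraints are therefore treated as one
  family over a disjoint sum, and the multipliers as one function \<open>c\<close> on it.

  \<^item> At each \<open>x\<^sub>k\<close> the multiplier may be chosen with linearly independent gradients on its
    support, without changing a sign
    (\<open>sign_preserving_independent_support\<close>).  There are finitely many supports, so along
    a subsequence the support is a fixed set \<open>S\<close>.

  \<^item> The multipliers then have a convergent subsequence: otherwise their normalisations would
    produce a positive linear dependence on \<open>S\<close> at \<open>x\<^sup>*\<close>, which CC-CPLD would spread to a
    linear dependence at all \<open>x\<^sub>k\<close> close to \<open>x\<^sup>*\<close>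
    (\<open>tight_multipliers_convergent_subseq\<close>).  The limit is an M-stationary multiplier at
    \<open>(x\<^sup>*, y\<^sup>*)\<close>.

  \<^item> The pair \<open>(d, 0)\<close> is critical.  Each constraint in \<open>S\<close> vanishes at all \<open>x\<^sub>k\<close> and at
    \<open>x\<^sup>*\<close>, so its gradient is orthogonal to \<open>d\<close>, and by stationarity so is the gradient of
    \<open>f\<close>.

  \<^item> Subtracting the stationarity equations at \<open>x\<^sub>k\<close> and \<open>x\<^sup>*\<close> and dividing twice by
    \<open>\<parallel>x\<^sub>k - x\<^sup>*\<parallel>\<close> gives the Hessian form at \<open>d\<close> in the limit, up to the terms
    \<open>(c\<^sub>k j - c\<^sup>* j) (\<nabla>F\<^sub>j(x\<^sup>*) \<bullet> (x\<^sub>k - x\<^sup>*)) / \<parallel>x\<^sub>k - x\<^sup>*\<parallel>\<^sup>2\<close>.  Since \<open>F\<^sub>j\<close> vanishes at both points, the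
    last factor is bounded, so these terms tend to zero (\<open>second_order_limit_zero\<close>).
\<close>

section \<open>Norms and convergent subsequences\<close>

text \<open>
  Half of the equivalence of norms on a finite-dimensional space, by compactness of the unit sphere.
  It makes convergence with respect to an arbitrary norm imply ordinary convergence.
\<close>

lemma is_norm_dominates_norm:
  fixes N :: "'a::euclidean_space \<Rightarrow> real"
  assumes "is_norm N"
  obtains C where "C > 0" "\<And>v. C * norm v \<le> N v"
proof -
  have N0: "\<And>v. 0 \<le> N v" and Nz: "\<And>v. N v = 0 \<longleftrightarrow> v = 0"
    and Ns: "\<And>c v. N (c *\<^sub>R v) = \<bar>c\<bar> * N v" and Nt: "\<And>v w. N (v + w) \<le> N v + N w"
    using assms unfolding is_norm_def by auto
  define K where "K = (\<Sum>b\<in>Basis. N b)"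
  have Nsum: "N (\<Sum>b\<in>B. w b) \<le> (\<Sum>b\<in>B. N (w b))" if "finite B" for B :: "'a set" and w
    using that
  proof (induction B rule: finite_induct)
    case empty
    then show ?case using Nz[of 0] by simp
  next
    case (insert b B)
    then show ?case using Nt[of "w b" "\<Sum>b\<in>B. w b"] by simp
  qed
  have upper: "N v \<le> K * norm v" for v
  proof -
    have "N v = N (\<Sum>b\<in>Basis. (v \<bullet> b) *\<^sub>R b)"
      by (simp add: euclidean_representation)
    also have "\<dots> \<le> (\<Sum>b\<in>Basis. \<bar>v \<bullet> b\<bar> * N b)"
      using Nsum[of Basis "\<lambda>b. (v \<bullet> b) *\<^sub>R b"] by (simp add: Ns)
    also have "\<dots> \<le> (\<Sum>b\<in>Basis. norm v * N b)"
      by (intro sum_mono mult_right_mono N0) (simp add: Basis_le_norm)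
    finally show ?thesis
      by (simp add: K_def sum_distrib_left mult.commute)
  qed
  have lip: "\<bar>N v - N w\<bar> \<le> K * norm (v - w)" for v w
    using Nt[of "v - w" w] Nt[of "w - v" v] upper[of "v - w"] upper[of "w - v"]
    by (simp add: norm_minus_commute)
  have K0: "0 \<le> K"
    unfolding K_def by (intro sum_nonneg N0)
  have cont: "continuous_on (sphere 0 1) N"
  proof (rule lipschitz_on_continuous_on)
    show "K-lipschitz_on (sphere 0 1) N"
      by (rule lipschitz_onI) (auto simp: dist_norm lip K0)
  qed
  have "compact (sphere (0::'a) 1)" "sphere (0::'a) 1 \<noteq> {}"
    by auto
  then obtain u where u: "u \<in> sphere 0 1" and min: "\<And>v. v \<in> sphere 0 1 \<Longrightarrow> N u \<le> N v"
    using continuous_attains_inf[OF _ _ cont] by blast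
  show thesis
  proof
    show "N u > 0"
      using u N0[of u] Nz[of u] by (force simp: less_le)
    show "N u * norm v \<le> N v" for v
    proof (cases "v = 0")
      case False
      then have "N u \<le> N ((1 / norm v) *\<^sub>R v)"
        by (intro min) simp
      with False show ?thesis
        by (simp add: Ns field_simps)
    qed (simp add: N0)
  qed
qed

lemma bounded_family_convergent_subseq:
  fixes a :: "nat \<Rightarrow> 'i \<Rightarrow> real"
  assumes "finite S" and "\<And>k j. j \<in> S \<Longrightarrow> \<bar>a k j\<bar> \<le> C"
  shows "\<exists>l r. strict_mono r \<and> (\<forall>j\<in>S. (\<lambda>k. a (r k) j) \<longlonglongrightarrow> l j)"
  using assms
proof (induction S rule: finite_induct)
  case empty
  then show ?case using strict_mono_id by auto
next
  case (insert i S)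
  then obtain l r where r: "strict_mono r" "\<forall>j\<in>S. (\<lambda>k. a (r k) j) \<longlonglongrightarrow> l j"
    by auto
  have "bounded (range (\<lambda>k. a (r k) i))"
    using insert.prems by (auto simp: bounded_iff)
  then obtain l' r' where r': "strict_mono (r' :: nat \<Rightarrow> nat)" "((\<lambda>k. a (r k) i) \<circ> r') \<longlonglongrightarrow> l'"
    using bounded_imp_convergent_subsequence by blast
  have "strict_mono (r \<circ> r')"
    using r r' strict_mono_o by blast
  moreover have "(\<lambda>k. a ((r \<circ> r') k) j) \<longlonglongrightarrow> (if j = i then l' else l j)" if "j \<in> insert i S" for j
  proof (cases "j = i")
    case True
    then show ?thesis using r' by (simp add: o_def)
  next
    case False
    then have "(\<lambda>k. a (r k) j) \<longlonglongrightarrow> l j"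
      using that r by auto
    from LIMSEQ_subseq_LIMSEQ[OF this r'(1)] False show ?thesis
      by (simp add: o_def)
  qed
  ultimately show ?case
    by (intro exI[of _ "\<lambda>j. if j = i then l' else l j"] exI[of _ "r \<circ> r'"]) blast
qed

section \<open>Multipliers with linearly independent support\<close>

text \<open>
  Caratheodory's argument.  While the vectors on the support of \<open>c\<close> are dependent, with
  coefficients \<open>u\<close>, move from \<open>c\<close> along \<open>u\<close> up to the first zero of a coefficient.
  No coefficient changes sign before that, so the constraints on the signs of multipliers and
  their complementarity persist.
\<close>

lemma sign_preserving_independent_support:
  fixes V :: "'i \<Rightarrow> 'v::real_vector" and c :: "'i \<Rightarrow> real"
  assumes "finite J"
  shows "\<exists>c'. (\<forall>j\<in>J. c' j \<noteq> 0 \<longrightarrow> c' j * c j > 0) \<and>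
              (\<Sum>j\<in>J. c' j *\<^sub>R V j) = (\<Sum>j\<in>J. c j *\<^sub>R V j) \<and>
              \<not> lin_dep {j\<in>J. c' j \<noteq> 0} V"
proof (induction "card {j\<in>J. c j \<noteq> 0}" arbitrary: c rule: less_induct)
  case less
  define S where "S = {j\<in>J. c j \<noteq> 0}"
  have fS: "finite S"
    using assms by (simp add: S_def)
  show ?case
  proof (cases "lin_dep S V")
    case False
    then show ?thesis
      by (intro exI[of _ c]) (auto simp: S_def zero_less_mult_iff linorder_neq_iff)
  next
    case True
    then obtain u0 where u0: "\<exists>j\<in>S. u0 j \<noteq> 0" "(\<Sum>j\<in>S. u0 j *\<^sub>R V j) = 0"
      by (auto simp: lin_dep_def)
    define u where "u j = (if j \<in> S then u0 j else 0)" for j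
    have uJ: "(\<Sum>j\<in>J. u j *\<^sub>R V j) = 0"
    proof -
      have "(\<Sum>j\<in>J. u j *\<^sub>R V j) = (\<Sum>j\<in>S. u0 j *\<^sub>R V j)"
        by (rule sum.mono_neutral_cong_right) (auto simp: u_def S_def assms)
      with u0 show ?thesis by simp
    qed
    \<comment> \<open>The step from \<open>c\<close> along \<open>u\<close> kills the coefficient with the smallest ratio, hence
        by \<open>small\<close> no coefficient crosses zero.\<close>
    define T where "T = {j\<in>S. u j \<noteq> 0}"
    have "finite T" "T \<noteq> {}"
      using fS u0 by (auto simp: T_def u_def)
    then obtain i where i: "i \<in> T" and min: "\<And>j. j \<in> T \<Longrightarrow> \<bar>c i / u i\<bar> \<le> \<bar>c j / u j\<bar>"
      using ex_min_if_finite[of "(\<lambda>j. \<bar>c j / u j\<bar>) ` T"] by (force simp: not_less)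
    define c1 where "c1 j = c j - (c i / u i) * u j" for j
    have small: "\<bar>(c i / u i) * u j\<bar> \<le> \<bar>c j\<bar>" for j
    proof (cases "j \<in> T")
      case True
      then have "u j \<noteq> 0" by (simp add: T_def)
      then show ?thesis
        using min[OF True] by (simp add: abs_mult abs_divide field_simps)
    qed (auto simp: T_def u_def)
    have c1: "c1 j * c j > 0" if "c1 j \<noteq> 0" for j
      using small[of j] that unfolding c1_def
      by (cases "c j" "0::real" rule: linorder_cases) (auto simp: zero_less_mult_iff abs_if split: if_splits)
    have "{j\<in>J. c1 j \<noteq> 0} \<subseteq> S - {i}"
    proof -
      have "c1 i = 0" using i by (simp add: c1_def T_def)
      then show ?thesis using c1 by (fastforce simp: S_def)
    qed
    then have "card {j\<in>J. c1 j \<noteq> 0} < card S"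
      using i fS by (intro psubset_card_mono) (auto simp: T_def)
    from less[OF this[unfolded S_def]] obtain c2 where
      c2: "\<forall>j\<in>J. c2 j \<noteq> 0 \<longrightarrow> c2 j * c1 j > 0"
          "(\<Sum>j\<in>J. c2 j *\<^sub>R V j) = (\<Sum>j\<in>J. c1 j *\<^sub>R V j)" "\<not> lin_dep {j\<in>J. c2 j \<noteq> 0} V"
      by blast
    have "(\<Sum>j\<in>J. c1 j *\<^sub>R V j) = (\<Sum>j\<in>J. c j *\<^sub>R V j) - (c i / u i) *\<^sub>R (\<Sum>j\<in>J. u j *\<^sub>R V j)"
      by (simp add: c1_def algebra_simps sum_subtractf scaleR_sum_right)
    then have "(\<Sum>j\<in>J. c1 j *\<^sub>R V j) = (\<Sum>j\<in>J. c j *\<^sub>R V j)"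
      using uJ by simp
    moreover have "c2 j * c j > 0" if "j \<in> J" "c2 j \<noteq> 0" for j
    proof -
      have "c2 j * c1 j > 0" using c2 that by blast
      moreover from this have "c1 j * c j > 0" using c1[of j] by fastforce
      ultimately show ?thesis by (auto simp: zero_less_mult_iff)
    qed
    ultimately show ?thesis
      using c2 by (intro exI[of _ c2]) auto
  qed
qed

text \<open>
  Dividing the multipliers by \<open>1 + \<Sum>\<bar>c k j\<bar>\<close> makes them bounded without a case distinction
  on whether they were.  If the limit \<open>t\<close> of the factors is positive, the multipliers themselves
  converge.  If it is zero, the limit of the scaled multipliers is a combination with value zero
  that the independence assumption forces to be trivial, although its absolute values add up to one.
\<close>

lemma multipliers_convergent_subseq:
  fixes V :: "nat \<Rightarrow> 'i \<Rightarrow> 'v::real_normed_vector" and c :: "nat \<Rightarrow> 'i \<Rightarrow> real"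
  assumes fS: "finite S"
    and V: "\<And>j. j \<in> S \<Longrightarrow> (\<lambda>k. V k j) \<longlonglongrightarrow> V0 j"
    and w: "w \<longlonglongrightarrow> w0"
    and eq: "\<And>k. (\<Sum>j\<in>S. c k j *\<^sub>R V k j) = w k"
    and pos: "\<And>k j. j \<in> S \<Longrightarrow> P j \<Longrightarrow> c k j \<ge> 0"
    and indep: "\<And>u. (\<And>j. j \<in> S \<Longrightarrow> P j \<Longrightarrow> u j \<ge> 0) \<Longrightarrow> (\<Sum>j\<in>S. u j *\<^sub>R V0 j) = 0 \<Longrightarrow>
                  (\<forall>j\<in>S. u j = 0)"
  shows "\<exists>c0 r. strict_mono r \<and> (\<forall>j\<in>S. (\<lambda>k. c (r k) j) \<longlonglongrightarrow> c0 j)"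
proof -
  define s where "s k = 1 + (\<Sum>j\<in>S. \<bar>c k j\<bar>)" for k
  have s1: "s k \<ge> 1" for k
    unfolding s_def by (simp add: sum_nonneg)
  define a where "a k j = c k j / s k" for k j
  have bound: "\<bar>a k j\<bar> \<le> 1" if "j \<in> S" for k j
  proof -
    have "\<bar>c k j\<bar> \<le> (\<Sum>j\<in>S. \<bar>c k j\<bar>)"
      by (rule member_le_sum) (use that fS in auto)
    also have "\<dots> \<le> s k" by (simp add: s_def)
    finally show ?thesis using s1[of k] by (simp add: a_def abs_divide field_simps)
  qed
  from bounded_family_convergent_subseq[of S a 1, OF fS bound] obtain u r
    where r: "strict_mono r" and u: "\<And>j. j \<in> S \<Longrightarrow> (\<lambda>k. a (r k) j) \<longlonglongrightarrow> u j"
    by blast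
  \<comment> \<open>The limit of the scaling factors \<open>1 / s\<close>, by the identity \<open>inv\<close> below.\<close>
  define t where "t = 1 - (\<Sum>j\<in>S. \<bar>u j\<bar>)"
  have inv: "1 / s k = 1 - (\<Sum>j\<in>S. \<bar>a k j\<bar>)" for k
  proof -
    have "(\<Sum>j\<in>S. \<bar>a k j\<bar>) = (\<Sum>j\<in>S. \<bar>c k j\<bar>) / s k"
      using s1[of k] by (simp add: a_def abs_divide sum_divide_distrib)
    also have "\<dots> = (s k - 1) / s k"
      by (simp add: s_def)
    finally show ?thesis using s1[of k] by (simp add: field_simps)
  qed
  have t: "(\<lambda>k. 1 / s (r k)) \<longlonglongrightarrow> t"
    unfolding inv t_def by (intro tendsto_intros u)
  have "(\<lambda>k. \<Sum>j\<in>S. a (r k) j *\<^sub>R V (r k) j) \<longlonglongrightarrow> (\<Sum>j\<in>S. u j *\<^sub>R V0 j)"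
    using LIMSEQ_subseq_LIMSEQ[OF V r] by (intro tendsto_intros u) (auto simp: o_def)
  moreover have "(\<Sum>j\<in>S. a k j *\<^sub>R V k j) = (1 / s k) *\<^sub>R w k" for k
    unfolding eq[symmetric] by (simp add: a_def scaleR_sum_right)
  moreover have "(\<lambda>k. (1 / s (r k)) *\<^sub>R w (r k)) \<longlonglongrightarrow> t *\<^sub>R w0"
    using LIMSEQ_subseq_LIMSEQ[OF w r] by (intro tendsto_scaleR t) (auto simp: o_def)
  ultimately have uV: "(\<Sum>j\<in>S. u j *\<^sub>R V0 j) = t *\<^sub>R w0"
    using LIMSEQ_unique by simp blast
  have upos: "u j \<ge> 0" if "j \<in> S" "P j" for j
    using u[OF that(1)]
  proof (rule tendsto_lowerbound)
    show "\<forall>\<^sub>F k in sequentially. 0 \<le> a (r k) j"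
      using pos[OF that] s1 by (intro always_eventually allI) (simp add: a_def order_trans[OF zero_le_one])
  qed simp
  have "t \<noteq> 0"
  proof
    assume "t = 0"
    then have "\<forall>j\<in>S. u j = 0" using indep[of u] upos uV by simp
    with \<open>t = 0\<close> show False by (simp add: t_def)
  qed
  have "(\<lambda>k. c (r k) j) \<longlonglongrightarrow> u j / t" if "j \<in> S" for j
  proof -
    have "(\<lambda>k. a (r k) j / (1 / s (r k))) \<longlonglongrightarrow> u j / t"
      by (intro tendsto_divide u that t \<open>t \<noteq> 0\<close>)
    moreover have "a k j / (1 / s k) = c k j" for k
      using s1[of k] by (simp add: a_def)
    ultimately show ?thesis by simp
  qed
  with r show ?thesis by (intro exI[of _ "\<lambda>j. u j / t"] exI[of _ r]) blast
qed

section \<open>Expansions along a direction of approach\<close>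

lemma directional_limit:
  fixes F :: "'a::real_normed_vector \<Rightarrow> 'b::real_normed_vector"
  assumes F: "(F has_derivative D) (at a)"
    and X: "X \<longlonglongrightarrow> a" "\<And>k. X k \<noteq> a"
    and d: "(\<lambda>k. (X k - a) /\<^sub>R norm (X k - a)) \<longlonglongrightarrow> d"
  shows "(\<lambda>k. (F (X k) - F a) /\<^sub>R norm (X k - a)) \<longlonglongrightarrow> D d"
proof -
  have bl: "bounded_linear D"
    using F by (rule has_derivative_bounded_linear)
  have "filterlim X (at a) sequentially"
    using X by (simp add: filterlim_at)
  moreover have "((\<lambda>y. (F y - F a - D (y - a)) /\<^sub>R norm (y - a)) \<longlongrightarrow> 0) (at a)"
    using F by (simp add: has_derivative_at_within)
  ultimately have "(\<lambda>k. (F (X k) - F a - D (X k - a)) /\<^sub>R norm (X k - a)) \<longlonglongrightarrow> 0"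
    by (rule filterlim_compose[rotated])
  moreover have "(\<lambda>k. D ((X k - a) /\<^sub>R norm (X k - a))) \<longlonglongrightarrow> D d"
    by (rule bounded_linear.tendsto[OF bl d])
  ultimately have "(\<lambda>k. (F (X k) - F a - D (X k - a)) /\<^sub>R norm (X k - a)
                      + D ((X k - a) /\<^sub>R norm (X k - a))) \<longlonglongrightarrow> 0 + D d"
    by (rule tendsto_add)
  then show ?thesis
    by (simp add: linear_simps[OF bl] scaleR_diff_right)
qed

text \<open>
  Differentiability of the gradient at the single point \<open>a\<close> makes it Lipschitz relative to
  \<open>a\<close>, and the mean value theorem turns this into a quadratic bound of the first-order remainder.
\<close>

lemma quadratic_remainder_bound:
  fixes F :: "'a::real_inner \<Rightarrow> real"
  assumes F: "\<And>x. GDERIV F x :> G x"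
    and G: "(G has_derivative D) (at a)"
  obtains C where "\<forall>\<^sub>F x in nhds a. \<bar>F x - F a - G a \<bullet> (x - a)\<bar> \<le> C * (norm (x - a))\<^sup>2"
proof -
  obtain K where K: "\<And>v. norm (D v) \<le> norm v * K"
    using bounded_linear.bounded[OF has_derivative_bounded_linear[OF G]] by blast
  obtain \<delta> where "\<delta> > 0" and
    \<delta>: "\<And>y. norm (y - a) < \<delta> \<Longrightarrow> norm (G y - G a - D (y - a)) \<le> 1 * norm (y - a)"
    using G unfolding has_derivative_at_alt by (metis zero_less_one)
  have lip: "norm (G y - G a) \<le> (K + 1) * norm (y - a)" if "norm (y - a) < \<delta>" for y
    using norm_triangle_sub[of "G y - G a" "D (y - a)"] \<delta>[OF that] K[of "y - a"]
    by (simp add: algebra_simps)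
  have K0: "0 \<le> K + 1" if "x \<noteq> a" "norm (x - a) < \<delta>" for x
    using lip[OF that(2)] that(1) norm_ge_zero[of "G x - G a"]
    by (smt (verit) mult_neg_pos right_minus_eq zero_less_norm_iff)
  have "\<bar>F x - F a - G a \<bullet> (x - a)\<bar> \<le> (K + 1) * (norm (x - a))\<^sup>2" if x: "norm (x - a) < \<delta>" for x
  proof (cases "x = a")
    case False
    define v where "v = x - a"
    have "((\<lambda>s. F (a + s *\<^sub>R v)) has_derivative (\<lambda>ds. (ds *\<^sub>R v) \<bullet> G (a + s *\<^sub>R v))) (at s)" for s
    proof -
      have "((\<lambda>s. a + s *\<^sub>R v) has_derivative (\<lambda>ds. ds *\<^sub>R v)) (at s)"
        by (auto intro!: derivative_eq_intros)
      from has_derivative_compose[OF this F[of "a + s *\<^sub>R v", unfolded gderiv_def]]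
      show ?thesis .
    qed
    then have "\<exists>s\<in>{0<..<1}. F (a + 1 *\<^sub>R v) - F (a + 0 *\<^sub>R v) = ((1 - 0) *\<^sub>R v) \<bullet> G (a + s *\<^sub>R v)"
      by (intro mvt_simple[of 0 1 "\<lambda>s. F (a + s *\<^sub>R v)" "\<lambda>s ds. (ds *\<^sub>R v) \<bullet> G (a + s *\<^sub>R v)"])
         (auto intro: has_derivative_at_withinI)
    then obtain s where s: "0 < s" "s < 1" and mv: "F x - F a = v \<bullet> G (a + s *\<^sub>R v)"
      by (auto simp: v_def)
    have sv: "norm ((a + s *\<^sub>R v) - a) \<le> norm v"
      using s by (simp add: mult_left_le_one_le)
    have "\<bar>F x - F a - G a \<bullet> (x - a)\<bar> = \<bar>v \<bullet> (G (a + s *\<^sub>R v) - G a)\<bar>"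
      by (simp add: mv v_def inner_diff_right inner_commute)
    also have "\<dots> \<le> norm v * norm (G (a + s *\<^sub>R v) - G a)"
      by (rule Cauchy_Schwarz_ineq2)
    also have "\<dots> \<le> norm v * ((K + 1) * norm v)"
    proof (rule mult_left_mono)
      have "norm (G (a + s *\<^sub>R v) - G a) \<le> (K + 1) * norm ((a + s *\<^sub>R v) - a)"
        using sv x by (intro lip) (simp add: v_def)
      also have "\<dots> \<le> (K + 1) * norm v"
        using sv K0[OF False x] by (rule mult_left_mono)
      finally show "norm (G (a + s *\<^sub>R v) - G a) \<le> (K + 1) * norm v" .
    qed simp
    finally show ?thesis
      by (simp add: v_def power2_eq_square algebra_simps)
  qed simp
  then show thesis
    using \<open>\<delta> > 0\<close> by (intro that) (auto simp: eventually_nhds_metric dist_norm)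
qed

text \<open>
  The form cannot simply be read off from the difference of the two stationarity equations,
  because the multipliers differ as well and nothing is known about the speed of their
  convergence.  Activity at both points helps: it makes \<open>G j a \<bullet> (X k - a)\<close> quadratically
  small, so mere convergence of the multipliers suffices.
\<close>

lemma second_order_limit_zero:
  fixes X :: "nat \<Rightarrow> 'a::real_inner"
  assumes "finite S"
    and X: "X \<longlonglongrightarrow> a" "\<And>k. X k \<noteq> a"
    and d: "(\<lambda>k. (X k - a) /\<^sub>R norm (X k - a)) \<longlonglongrightarrow> d"
    and G0: "(G0 has_derivative D0) (at a)"
    and F: "\<And>j x. j \<in> S \<Longrightarrow> GDERIV (F j) x :> G j x"
    and G: "\<And>j. j \<in> S \<Longrightarrow> (G j has_derivative D j) (at a)"
    and c: "\<And>j. j \<in> S \<Longrightarrow> (\<lambda>k. c k j) \<longlonglongrightarrow> c0 j"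
    and stat: "\<And>k. G0 (X k) + (\<Sum>j\<in>S. c k j *\<^sub>R G j (X k)) = 0"
    and stat0: "G0 a + (\<Sum>j\<in>S. c0 j *\<^sub>R G j a) = 0"
    and act: "\<And>k j. j \<in> S \<Longrightarrow> F j (X k) = F j a"
  shows "d \<bullet> (D0 d + (\<Sum>j\<in>S. c0 j *\<^sub>R D j d)) = 0"
proof -
  let ?t = "\<lambda>k. norm (X k - a)"
  define e where "e k = (X k - a) /\<^sub>R ?t k" for k
  have tpos: "?t k > 0" for k using X by simp
  \<comment> \<open>The same quantity tends to the quadratic form (\<open>lhs\<close>) and, by the two stationarity
      equations (\<open>eq\<close>), to zero.\<close>
  have lhs: "(\<lambda>k. e k \<bullet> ((G0 (X k) - G0 a) /\<^sub>R ?t k + (\<Sum>j\<in>S. c k j *\<^sub>R ((G j (X k) - G j a) /\<^sub>R ?t k))))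
     \<longlonglongrightarrow> d \<bullet> (D0 d + (\<Sum>j\<in>S. c0 j *\<^sub>R D j d))"
    by (intro tendsto_intros c d[folded e_def] directional_limit[OF G0 X d] directional_limit[OF G X d])
  have eq: "e k \<bullet> ((G0 (X k) - G0 a) /\<^sub>R ?t k + (\<Sum>j\<in>S. c k j *\<^sub>R ((G j (X k) - G j a) /\<^sub>R ?t k)))
      = - (\<Sum>j\<in>S. (c k j - c0 j) * ((G j a \<bullet> (X k - a)) / (?t k)\<^sup>2))" for k
  proof -
    have "(G0 (X k) - G0 a) + (\<Sum>j\<in>S. c k j *\<^sub>R (G j (X k) - G j a))
        = (G0 (X k) + (\<Sum>j\<in>S. c k j *\<^sub>R G j (X k))) - (G0 a + (\<Sum>j\<in>S. c0 j *\<^sub>R G j a))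
          - (\<Sum>j\<in>S. (c k j - c0 j) *\<^sub>R G j a)"
      by (simp add: algebra_simps sum_subtractf sum.distrib)
    then have *: "(G0 (X k) - G0 a) + (\<Sum>j\<in>S. c k j *\<^sub>R (G j (X k) - G j a))
        = - (\<Sum>j\<in>S. (c k j - c0 j) *\<^sub>R G j a)"
      by (simp add: stat stat0)
    have "(G0 (X k) - G0 a) /\<^sub>R ?t k + (\<Sum>j\<in>S. c k j *\<^sub>R ((G j (X k) - G j a) /\<^sub>R ?t k))
        = ((G0 (X k) - G0 a) + (\<Sum>j\<in>S. c k j *\<^sub>R (G j (X k) - G j a))) /\<^sub>R ?t k"
      by (simp add: scaleR_add_right scaleR_sum_right mult.commute)
    also have "\<dots> = (- (\<Sum>j\<in>S. (c k j - c0 j) *\<^sub>R G j a)) /\<^sub>R ?t k"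
      by (simp only: *)
    finally show ?thesis
      by (simp add: e_def inner_sum_right sum_distrib_left power2_eq_square divide_inverse
          inner_commute ac_simps)
  qed
  have "(\<lambda>k. (c k j - c0 j) * ((G j a \<bullet> (X k - a)) / (?t k)\<^sup>2)) \<longlonglongrightarrow> 0" if j: "j \<in> S" for j
  proof -
    obtain C where C: "\<forall>\<^sub>F x in nhds a. \<bar>F j x - F j a - G j a \<bullet> (x - a)\<bar> \<le> C * (norm (x - a))\<^sup>2"
      using quadratic_remainder_bound[OF F[OF j] G[OF j]] by blast
    have "\<forall>\<^sub>F k in sequentially. \<bar>F j (X k) - F j a - G j a \<bullet> (X k - a)\<bar> \<le> C * (?t k)\<^sup>2"
      by (rule eventually_compose_filterlim[OF C X(1)])
    then have "\<forall>\<^sub>F k in sequentially. norm ((G j a \<bullet> (X k - a)) / (?t k)\<^sup>2) \<le> C"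
      by (rule eventually_mono) (use act[OF j] tpos in \<open>simp add: field_simps\<close>)
    then have "Bfun (\<lambda>k. (G j a \<bullet> (X k - a)) / (?t k)\<^sup>2) sequentially"
      by (rule BfunI)
    moreover have "Zfun (\<lambda>k. c k j - c0 j) sequentially"
      using c[OF j] by (simp add: tendsto_Zfun_iff)
    ultimately have "Zfun (\<lambda>k. (c k j - c0 j) * ((G j a \<bullet> (X k - a)) / (?t k)\<^sup>2)) sequentially"
      by (intro bounded_bilinear.Zfun_prod_Bfun[OF bounded_bilinear_mult])
    then show ?thesis by (simp add: tendsto_Zfun_iff)
  qed
  then have "(\<lambda>k. - (\<Sum>j\<in>S. (c k j - c0 j) * ((G j a \<bullet> (X k - a)) / (?t k)\<^sup>2))) \<longlonglongrightarrow> - (\<Sum>j\<in>S. 0)"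
    by (intro tendsto_intros)
  with lhs show ?thesis
    unfolding eq using LIMSEQ_unique by fastforce
qed


section \<open>M-stationarity as stationarity with vanishing components as equality constraints\<close>

definition constr_index :: "nat \<Rightarrow> nat \<Rightarrow> (nat + nat + 'n::finite) set" where
  "constr_index m p = {1..m} <+> ({1..p} <+> UNIV)"

definition constr ::
  "(nat \<Rightarrow> real ^ 'n \<Rightarrow> real) \<Rightarrow> (nat \<Rightarrow> real ^ 'n \<Rightarrow> real) \<Rightarrow> nat + nat + 'n \<Rightarrow> real ^ 'n \<Rightarrow> real" where
  "constr g h = case_sum g (case_sum h (\<lambda>i z. z $ i))"

definition constr_grad ::
  "(nat \<Rightarrow> real ^ 'n \<Rightarrow> real) \<Rightarrow> (nat \<Rightarrow> real ^ 'n \<Rightarrow> real) \<Rightarrow> real ^ 'n \<Rightarrow> nat + nat + 'n \<Rightarrow> real ^ 'n" where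
  "constr_grad g h z =
     case_sum (\<lambda>i. grad (g i) z) (case_sum (\<lambda>i. grad (h i) z) (\<lambda>i. axis i 1))"

definition constr_hess ::
  "(nat \<Rightarrow> real ^ 'n \<Rightarrow> real) \<Rightarrow> (nat \<Rightarrow> real ^ 'n \<Rightarrow> real) \<Rightarrow> real ^ 'n \<Rightarrow> nat + nat + 'n \<Rightarrow> real ^ 'n ^ 'n" where
  "constr_hess g h z =
     case_sum (\<lambda>i. hessian (g i) z) (case_sum (\<lambda>i. hessian (h i) z) (\<lambda>i. 0))"

text \<open>
  KKT multipliers, apart from feasibility, of the problem in \<open>x\<close> alone that has the additional
  equality constraints \<open>x $ i = 0\<close>.  Which of these constraints count at \<open>x\<close> is encoded by
  complementarity: a component \<open>x $ i \<noteq> 0\<close> forces the multiplier of the coordinate to vanish.  Being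
  an equation, this passes to the limit without comparing index sets at different points.
\<close>

definition tight_multiplier ::
  "nat \<Rightarrow> nat \<Rightarrow> (real ^ 'n \<Rightarrow> real) \<Rightarrow> (nat \<Rightarrow> real ^ 'n \<Rightarrow> real) \<Rightarrow> (nat \<Rightarrow> real ^ 'n \<Rightarrow> real) \<Rightarrow>
    real ^ 'n \<Rightarrow> (nat + nat + 'n \<Rightarrow> real) \<Rightarrow> bool" where
  "tight_multiplier m p f g h x c \<longleftrightarrow>
     grad f x + (\<Sum>j\<in>constr_index m p. c j *\<^sub>R constr_grad g h x j) = 0 \<and>
     (\<forall>i\<in>{1..m}. c (Inl i) \<ge> 0) \<and>
     (\<forall>j\<in>constr_index m p. c j * constr g h j x = 0)"

lemma finite_constr_index [simp]: "finite (constr_index m p)"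
  by (simp add: constr_index_def)

lemma sum_constr_index:
  fixes F :: "nat + nat + 'n::finite \<Rightarrow> 'v::comm_monoid_add"
  shows "(\<Sum>j\<in>constr_index m p. F j)
    = (\<Sum>i=1..m. F (Inl i)) + (\<Sum>i=1..p. F (Inr (Inl i))) + (\<Sum>i\<in>UNIV. F (Inr (Inr i)))"
  by (simp add: constr_index_def sum.Plus add.assoc)

lemma ball_constr_index:
  "(\<forall>j\<in>constr_index m p. P j) \<longleftrightarrow>
     (\<forall>i\<in>{1..m}. P (Inl i)) \<and> (\<forall>i\<in>{1..p}. P (Inr (Inl i))) \<and> (\<forall>i. P (Inr (Inr i)))"
  unfolding constr_index_def by blast

text \<open>
  Feasibility enters through \<open>x $ i * y $ i = 0\<close>: it puts every index with
  \<open>x $ i \<noteq> 0\<close> into \<open>I_pm0 x y\<close>.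
\<close>

lemma M_multiplier_imp_tight:
  assumes "(x, y) \<in> feasZ m p \<kappa> g h" "M_multiplier m p f g h x y lam mu gam"
  shows "tight_multiplier m p f g h x (case_sum lam (case_sum mu (($) gam)))"
proof -
  have "gam $ i * x $ i = 0" for i
    using assms by (auto simp: M_multiplier_def feasZ_def I_pm0_def)
  then show ?thesis
    using assms
    by (auto simp: tight_multiplier_def M_multiplier_def feasZ_def constr_def constr_grad_def
        sum_constr_index ball_constr_index add.assoc)
qed

lemma tight_imp_M_multiplier:
  assumes "tight_multiplier m p f g h x c"
  shows "M_multiplier m p f g h x y (\<lambda>i. c (Inl i)) (\<lambda>i. c (Inr (Inl i))) (\<chi> i. c (Inr (Inr i)))"
  using assms
  by (auto simp: tight_multiplier_def M_multiplier_def constr_def constr_grad_def I_pm0_def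
      sum_constr_index ball_constr_index add.assoc)

lemma twice_cont_diff_GDERIV:
  assumes "twice_cont_diff f"
  shows "GDERIV f x :> grad f x"
  using assms by (intro GDERIV_grad) (simp add: twice_cont_diff_def)

lemma GDERIV_constr:
  assumes "\<And>i. i \<in> {1..m} \<Longrightarrow> twice_cont_diff (g i)"
    and "\<And>i. i \<in> {1..p} \<Longrightarrow> twice_cont_diff (h i)"
    and "j \<in> constr_index m p"
  shows "GDERIV (constr g h j) x :> constr_grad g h x j"
proof -
  have "GDERIV (\<lambda>z. z $ i) x :> axis i 1" for i
    unfolding gderiv_def inner_axis
    by (simp add: bounded_linear_imp_has_derivative bounded_linear_vec_nth)
  then show ?thesis
    using assms by (auto simp: constr_index_def constr_def constr_grad_def twice_cont_diff_GDERIV)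
qed

lemma constr_grad_has_derivative:
  assumes "\<And>i. i \<in> {1..m} \<Longrightarrow> twice_cont_diff (g i)"
    and "\<And>i. i \<in> {1..p} \<Longrightarrow> twice_cont_diff (h i)"
    and "j \<in> constr_index m p"
  shows "((\<lambda>z. constr_grad g h z j) has_derivative (\<lambda>d. constr_hess g h x j *v d)) (at x)"
  using assms
  by (auto simp: constr_index_def constr_grad_def constr_hess_def matrix_vector_mult_0
      intro!: hessian_has_derivative)

section \<open>Limits of multipliers under CC-CPLD\<close>

text \<open>
  CC-CPLD read backwards: independence at points arbitrarily close to \<open>xs\<close> excludes positive
  dependence at \<open>xs\<close>.  The summand \<open>Inl\<close> carries the inequality constraints, whose coefficients
  are restricted in sign.
\<close>

lemma CC_CPLD_pos_independent:
  assumes cpld: "CC_CPLD m p g h xs"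
    and S: "S \<subseteq> constr_index m p" and act: "\<And>j. j \<in> S \<Longrightarrow> constr g h j xs = 0"
    and X: "X \<longlonglongrightarrow> xs" and ind: "\<And>k. \<not> lin_dep S (constr_grad g h (X k))"
    and u: "\<And>j. j \<in> S \<Longrightarrow> isl j \<Longrightarrow> u j \<ge> 0" "(\<Sum>j\<in>S. u j *\<^sub>R constr_grad g h xs j) = 0"
  shows "\<forall>j\<in>S. u j = 0"
proof (rule ccontr)
  assume nz: "\<not> (\<forall>j\<in>S. u j = 0)"
  define I1 where "I1 = Inl -` S"
  define I2 where "I2 = (Inl -` Inr -` S)"
  define I3 where "I3 = (Inr -` Inr -` S)"
  have S_eq: "S = I1 <+> (I2 <+> I3)"
  proof (rule set_eqI)
    show "j \<in> S \<longleftrightarrow> j \<in> I1 <+> (I2 <+> I3)" for j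
      by (cases j; cases "projr j") (auto simp: I1_def I2_def I3_def)
  qed
  have sub: "I1 \<subseteq> I_g m g xs" "I2 \<subseteq> {1..p}" "I3 \<subseteq> I_0 xs"
    using S act by (fastforce simp: I1_def I2_def I3_def I_g_def I_0_def constr_index_def constr_def)+
  have fin: "finite I1" "finite I2" "finite I3"
    using sub by (auto intro: finite_subset simp: I_g_def)
  have "(\<Sum>i\<in>I1. u (Inl i) *\<^sub>R grad (g i) xs)
      + (\<Sum>j\<in>I2 <+> I3. u (Inr j) *\<^sub>R case_sum (\<lambda>i. grad (h i) xs) (\<lambda>i. axis i 1) j)
      = (\<Sum>j\<in>S. u j *\<^sub>R constr_grad g h xs j)"
    unfolding S_eq using fin by (simp add: sum.Plus constr_grad_def)
  moreover have "u (Inl i) \<ge> 0" if "i \<in> I1" for i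
    using u(1)[of "Inl i"] that by (simp add: I1_def)
  ultimately have "pos_lin_dep I1 (\<lambda>i. grad (g i) xs)
          (I2 <+> I3) (case_sum (\<lambda>i. grad (h i) xs) (\<lambda>i. axis i 1))"
    unfolding pos_lin_dep_def
    by (intro exI[of _ "\<lambda>i. u (Inl i)"] exI[of _ "\<lambda>j. u (Inr j)"])
       (use nz u(2) in \<open>auto simp: S_eq\<close>)
  then have "\<forall>\<^sub>F z in nhds xs. lin_dep S (constr_grad g h z)"
    using cpld sub unfolding CC_CPLD_def S_eq constr_grad_def by blast
  then have "\<forall>\<^sub>F k in sequentially. lin_dep S (constr_grad g h (X k))"
    using X by (rule eventually_compose_filterlim)
  with ind show False by simp
qed

text \<open>
  The common support \<open>S\<close> is part of the conclusion because the constraints in \<open>S\<close> are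
  active at every point of the subsequence, also those whose multiplier tends to zero.
\<close>

lemma tight_multipliers_convergent_subseq:
  assumes f: "twice_cont_diff f"
    and g: "\<And>i. i \<in> {1..m} \<Longrightarrow> twice_cont_diff (g i)"
    and h: "\<And>i. i \<in> {1..p} \<Longrightarrow> twice_cont_diff (h i)"
    and cpld: "CC_CPLD m p g h xs"
    and X: "X \<longlonglongrightarrow> xs"
    and stat: "\<And>k::nat. \<exists>c. tight_multiplier m p f g h (X k) c"
  obtains S r c c0 where
    "S \<subseteq> constr_index m p" "strict_mono (r :: nat \<Rightarrow> nat)"
    "\<And>k. tight_multiplier m p f g h (X (r k)) (c k)" "tight_multiplier m p f g h xs c0"
    "\<And>j. (\<lambda>k. c k j) \<longlonglongrightarrow> c0 j"
    "\<And>j. j \<notin> S \<Longrightarrow> c0 j = 0" "\<And>k j. c k j \<noteq> 0 \<longleftrightarrow> j \<in> S"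
    "\<And>j. j \<in> S \<Longrightarrow> constr g h j xs = 0"
proof -
  let ?J = "constr_index m p :: (nat + nat + 'a) set"
  let ?V = "\<lambda>x. constr_grad g h x"
  have "\<exists>c. tight_multiplier m p f g h (X k) c \<and> (\<forall>j. j \<notin> ?J \<longrightarrow> c j = 0) \<and>
            \<not> lin_dep {j. c j \<noteq> 0} (?V (X k))" for k
  proof -
    obtain c where c: "tight_multiplier m p f g h (X k) c" using stat by blast
    obtain c' where c': "\<forall>j\<in>?J. c' j \<noteq> 0 \<longrightarrow> c' j * c j > 0"
       "(\<Sum>j\<in>?J. c' j *\<^sub>R ?V (X k) j) = (\<Sum>j\<in>?J. c j *\<^sub>R ?V (X k) j)"
       "\<not> lin_dep {j\<in>?J. c' j \<noteq> 0} (?V (X k))"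
      using sign_preserving_independent_support[OF finite_constr_index] by blast
    \<comment> \<open>Cut off outside the index set, so that only finitely many supports can occur.\<close>
    define c'' where "c'' j = (if j \<in> ?J then c' j else 0)" for j
    have "(\<Sum>j\<in>?J. c'' j *\<^sub>R ?V (X k) j) = (\<Sum>j\<in>?J. c j *\<^sub>R ?V (X k) j)"
      using c'(2) by (simp add: c''_def)
    moreover have "c'' (Inl i) \<ge> 0" if "i \<in> {1..m}" for i
    proof (cases "c' (Inl i) = 0")
      case False
      moreover have "Inl i \<in> ?J" using that by (auto simp: constr_index_def)
      ultimately have "c' (Inl i) * c (Inl i) > 0" using c' by blast
      moreover have "c (Inl i) \<ge> 0" using c that by (auto simp: tight_multiplier_def)
      ultimately show ?thesis by (auto simp: c''_def zero_less_mult_iff)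
    qed (simp add: c''_def)
    moreover have "c'' j * constr g h j (X k) = 0" if j: "j \<in> ?J" for j
    proof (cases "c' j = 0")
      case False
      then have "c j \<noteq> 0" using c' j by fastforce
      then show ?thesis using c j by (auto simp: tight_multiplier_def)
    qed (simp add: c''_def)
    ultimately have "tight_multiplier m p f g h (X k) c''"
      using c by (auto simp: tight_multiplier_def)
    moreover have "{j. c'' j \<noteq> 0} = {j\<in>?J. c' j \<noteq> 0}"
      by (auto simp: c''_def)
    ultimately show ?thesis
      using c' by (intro exI[of _ c'']) (auto simp: c''_def)
  qed
  then obtain c where tm: "\<And>k. tight_multiplier m p f g h (X k) (c k)"
    and outside: "\<And>k j. j \<notin> ?J \<Longrightarrow> c k j = 0"
    and ind: "\<And>k. \<not> lin_dep {j. c k j \<noteq> 0} (?V (X k))"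
    by metis
  have "(\<lambda>k. {j. c k j \<noteq> 0}) ` UNIV \<subseteq> Pow ?J"
    using outside by auto
  then have "finite ((\<lambda>k. {j. c k j \<noteq> 0}) ` UNIV)"
    by (rule finite_subset) simp
  then obtain k0 where inf: "infinite {k. {j. c k j \<noteq> 0} = {j. c k0 j \<noteq> 0}}"
    using pigeonhole_infinite[of UNIV "\<lambda>k. {j. c k j \<noteq> 0}"] by auto
  define S where "S = {j. c k0 j \<noteq> 0}"
  have SJ: "S \<subseteq> ?J" using outside by (auto simp: S_def)
  then have fS: "finite S" by (rule finite_subset) simp
  obtain r1 :: "nat \<Rightarrow> nat" where r1: "strict_mono r1" and supp: "\<And>k. {j. c (r1 k) j \<noteq> 0} = S"
    using infinite_enumerate[OF inf] by (auto simp: S_def)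
  have nz: "c (r1 k) j \<noteq> 0 \<longleftrightarrow> j \<in> S" for k j
    using supp by blast
  have X1: "(\<lambda>k. X (r1 k)) \<longlonglongrightarrow> xs"
    using LIMSEQ_subseq_LIMSEQ[OF X r1] by (simp add: o_def)
  have contF: "(\<lambda>k. constr g h j (Y k)) \<longlonglongrightarrow> constr g h j xs"
    if "j \<in> ?J" "Y \<longlonglongrightarrow> xs" for j and Y :: "nat \<Rightarrow> real ^ 'a"
  proof -
    have "(constr g h j has_derivative (\<lambda>v. v \<bullet> ?V xs j)) (at xs)"
      using GDERIV_constr[of m g p h j xs] g h that(1) by (simp add: gderiv_def)
    then have "isCont (constr g h j) xs" by (rule has_derivative_continuous)
    then show ?thesis using that(2) by (rule isCont_tendsto_compose)
  qed
  have contV: "(\<lambda>k. ?V (Y k) j) \<longlonglongrightarrow> ?V xs j"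
    if "j \<in> ?J" "Y \<longlonglongrightarrow> xs" for j and Y :: "nat \<Rightarrow> real ^ 'a"
  proof -
    have "isCont (\<lambda>z. ?V z j) xs"
      using constr_grad_has_derivative[of m g p h j xs] g h that(1) has_derivative_continuous by blast
    then show ?thesis using that(2) by (rule isCont_tendsto_compose)
  qed
  have contf: "(\<lambda>k. grad f (Y k)) \<longlonglongrightarrow> grad f xs"
    if "Y \<longlonglongrightarrow> xs" for Y :: "nat \<Rightarrow> real ^ 'a"
    using isCont_tendsto_compose[OF has_derivative_continuous[OF hessian_has_derivative[OF f]] that] .
  have sumS: "(\<Sum>j\<in>?J. c (r1 k) j *\<^sub>R ?V z j) = (\<Sum>j\<in>S. c (r1 k) j *\<^sub>R ?V z j)" for k z
    by (rule sum.mono_neutral_right) (use SJ nz in auto)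
  have act: "constr g h j xs = 0" if "j \<in> S" for j
  proof -
    have "constr g h j (X (r1 k)) = 0" for k
      using tm[of "r1 k"] nz[of k j] that SJ by (auto simp: tight_multiplier_def)
    then show ?thesis
      using contF[OF _ X1, of j] that SJ LIMSEQ_unique[OF tendsto_const] by fastforce
  qed
  have "\<exists>c0 r. strict_mono r \<and> (\<forall>j\<in>S. (\<lambda>k. c (r1 (r k)) j) \<longlonglongrightarrow> c0 j)"
  proof (rule multipliers_convergent_subseq[where P = isl and c = "\<lambda>k. c (r1 k)"])
    show "(\<lambda>k. ?V (X (r1 k)) j) \<longlonglongrightarrow> ?V xs j" if "j \<in> S" for j
      using contV[OF _ X1] SJ that by blast
    show "(\<lambda>k. - grad f (X (r1 k))) \<longlonglongrightarrow> - grad f xs"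
      by (intro tendsto_minus contf X1)
    show "(\<Sum>j\<in>S. c (r1 k) j *\<^sub>R ?V (X (r1 k)) j) = - grad f (X (r1 k))" for k
      using tm[of "r1 k"] unfolding tight_multiplier_def sumS
      by (metis add_eq_0_iff)
    show "0 \<le> c (r1 k) j" if "j \<in> S" "isl j" for k j
      using that SJ tm[of "r1 k"] by (auto simp: tight_multiplier_def constr_index_def isl_def)
    show "\<forall>j\<in>S. u j = 0"
      if "\<And>j. j \<in> S \<Longrightarrow> isl j \<Longrightarrow> 0 \<le> u j" "(\<Sum>j\<in>S. u j *\<^sub>R ?V xs j) = 0" for u
    proof (rule CC_CPLD_pos_independent[OF cpld SJ act X1 _ that])
      show "\<not> lin_dep S (?V (X (r1 k)))" for k
        using ind[of "r1 k"] unfolding supp .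
    qed
  qed (rule fS)
  then obtain c1 r where r: "strict_mono r" and c1: "\<And>j. j \<in> S \<Longrightarrow> (\<lambda>k. c (r1 (r k)) j) \<longlonglongrightarrow> c1 j"
    by blast
  define c0 where "c0 j = (if j \<in> S then c1 j else 0)" for j
  have lim: "(\<lambda>k. c (r1 (r k)) j) \<longlonglongrightarrow> c0 j" for j
    using c1[of j] nz[of _ j] by (cases "j \<in> S") (auto simp: c0_def)
  have X2: "(\<lambda>k. X (r1 (r k))) \<longlonglongrightarrow> xs"
    using LIMSEQ_subseq_LIMSEQ[OF X1 r] by (simp add: o_def)
  have "tight_multiplier m p f g h xs c0"
    unfolding tight_multiplier_def
  proof (intro conjI ballI)
    have "(\<lambda>k. grad f (X (r1 (r k))) + (\<Sum>j\<in>?J. c (r1 (r k)) j *\<^sub>R ?V (X (r1 (r k))) j))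
       \<longlonglongrightarrow> grad f xs + (\<Sum>j\<in>?J. c0 j *\<^sub>R ?V xs j)"
      by (intro tendsto_intros contf contV X2 lim)
    then show "grad f xs + (\<Sum>j\<in>?J. c0 j *\<^sub>R ?V xs j) = 0"
      using tm LIMSEQ_unique[OF tendsto_const] by (fastforce simp: tight_multiplier_def)
    show "0 \<le> c0 (Inl i)" if "i \<in> {1..m}" for i
      by (rule LIMSEQ_le_const[OF lim]) (use tm that in \<open>auto simp: tight_multiplier_def\<close>)
    show "c0 j * constr g h j xs = 0" for j
      using act by (auto simp: c0_def)
  qed
  then show thesis
    using SJ strict_mono_o[OF r1 r] tm lim nz act
    by (intro that[of S "r1 \<circ> r" "\<lambda>k. c (r1 (r k))" c0]) (auto simp: c0_def)
qed

section \<open>Local uniqueness\<close>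

text \<open>
  The critical direction has second component \<open>0\<close>: every condition of the cone on \<open>dy\<close> is then
  trivial, and the complementarity on \<open>I_00\<close> puts no restriction on \<open>dx\<close>.  On
  \<open>I_01 \<union> I_0p\<close> the component \<open>ys $ i\<close> is positive, hence so is that of the nearby points, whose
  \<open>x\<close>-component must vanish.
\<close>

lemma no_stationary_sequence:
  fixes f :: "real ^ 'n \<Rightarrow> real"
  assumes f: "twice_cont_diff f"
    and g: "\<And>i. i \<in> {1..m} \<Longrightarrow> twice_cont_diff (g i)"
    and h: "\<And>i. i \<in> {1..p} \<Longrightarrow> twice_cont_diff (h i)"
    and xs: "(xs, ys) \<in> feasZ m p \<kappa> g h"
    and cpld: "CC_CPLD m p g h xs"
    and sosc: "\<And>dx dy lam mu gam.
           (dx, dy) \<in> CC_crit_cone m p \<kappa> f g h xs ys \<Longrightarrow> dx \<noteq> 0 \<Longrightarrow>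
           M_multiplier m p f g h xs ys lam mu gam \<Longrightarrow>
           dx \<bullet> ((hessian f xs + (\<Sum>i=1..m. lam i *\<^sub>R hessian (g i) xs)
                    + (\<Sum>i=1..p. mu i *\<^sub>R hessian (h i) xs)) *v dx) > 0"
    and X: "X \<longlonglongrightarrow> xs" and Y: "Y \<longlonglongrightarrow> ys" and ne: "\<And>k. X k \<noteq> xs"
    and stat: "\<And>k::nat. M_stationary m p \<kappa> f g h (X k) (Y k)"
  shows False
proof -
  let ?J = "constr_index m p :: (nat + nat + 'n) set"
  have feas: "(X k, Y k) \<in> feasZ m p \<kappa> g h" for k
    using stat by (simp add: M_stationary_def)
  have ex: "\<exists>c. tight_multiplier m p f g h (X k) c" for k
    using stat[of k] M_multiplier_imp_tight by (fastforce simp: M_stationary_def)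
  obtain S r1 c c0 where SJ: "S \<subseteq> ?J" and r1: "strict_mono (r1 :: nat \<Rightarrow> nat)"
    and tm: "\<And>k. tight_multiplier m p f g h (X (r1 k)) (c k)" and tm0: "tight_multiplier m p f g h xs c0"
    and lim: "\<And>j. (\<lambda>k. c k j) \<longlonglongrightarrow> c0 j"
    and c0: "\<And>j. j \<notin> S \<Longrightarrow> c0 j = 0" and nz: "\<And>k j. c k j \<noteq> 0 \<longleftrightarrow> j \<in> S"
    and act: "\<And>j. j \<in> S \<Longrightarrow> constr g h j xs = 0"
    using tight_multipliers_convergent_subseq[OF f g h cpld X ex] by blast
  define E where "E k = (X (r1 k) - xs) /\<^sub>R norm (X (r1 k) - xs)" for k
  have "E k \<in> sphere 0 1" for k using ne by (simp add: E_def)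
  then obtain d r2 where d: "d \<in> sphere 0 1" and r2: "strict_mono (r2 :: nat \<Rightarrow> nat)"
    and Ed: "(E \<circ> r2) \<longlonglongrightarrow> d"
    using compact_sphere[of "0::real^'n" 1] unfolding compact_def by meson
  define W where "W k = X (r1 (r2 k))" for k
  have W: "W \<longlonglongrightarrow> xs"
    using LIMSEQ_subseq_LIMSEQ[OF LIMSEQ_subseq_LIMSEQ[OF X r1] r2] by (simp add: o_def W_def[abs_def])
  have Wne: "W k \<noteq> xs" for k using ne by (simp add: W_def)
  have Wd: "(\<lambda>k. (W k - xs) /\<^sub>R norm (W k - xs)) \<longlonglongrightarrow> d"
    using Ed by (simp add: o_def E_def W_def)
  have tmW: "tight_multiplier m p f g h (W k) (c (r2 k))" for k
    using tm by (simp add: W_def)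
  have limW: "(\<lambda>k. c (r2 k) j) \<longlonglongrightarrow> c0 j" for j
    using LIMSEQ_subseq_LIMSEQ[OF lim r2] by (simp add: o_def)
  have dd: "(\<lambda>k. (constr g h j (W k) - constr g h j xs) /\<^sub>R norm (W k - xs)) \<longlonglongrightarrow> d \<bullet> constr_grad g h xs j"
    if "j \<in> ?J" for j
    using directional_limit[OF _ W Wne Wd] GDERIV_constr[of m g p h j xs] g h that
    unfolding gderiv_def by blast
  have zero: "d \<bullet> constr_grad g h xs j = 0"
    if j: "j \<in> ?J" and "\<forall>\<^sub>F k in sequentially. constr g h j (W k) = constr g h j xs" for j
  proof -
    from that(2) have "\<forall>\<^sub>F k in sequentially. 0 = (constr g h j (W k) - constr g h j xs) /\<^sub>R norm (W k - xs)"
      by (rule eventually_mono) simp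
    then have "(\<lambda>k. (constr g h j (W k) - constr g h j xs) /\<^sub>R norm (W k - xs)) \<longlonglongrightarrow> 0"
      by (rule Lim_transform_eventually[OF tendsto_const])
    then show ?thesis using LIMSEQ_unique[OF dd[OF j]] by blast
  qed
  have actW: "constr g h j (W k) = 0" if "j \<in> S" for j k
    using tmW[of k] nz[of "r2 k" j] that SJ by (auto simp: tight_multiplier_def)
  have zeroS: "d \<bullet> constr_grad g h xs j = 0" if "j \<in> S" for j
    using zero[of j] actW act SJ that by auto
  have sumS: "(\<Sum>j\<in>?J. b j *\<^sub>R V j) = (\<Sum>j\<in>S. b j *\<^sub>R V j)"
    if "\<And>j. j \<notin> S \<Longrightarrow> b j = 0" for b and V :: "_ \<Rightarrow> real ^ 'n"
    by (rule sum.mono_neutral_right) (use SJ that in auto)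
  have stat0: "grad f xs + (\<Sum>j\<in>S. c0 j *\<^sub>R constr_grad g h xs j) = 0"
    using tm0 sumS[of c0] c0 by (simp add: tight_multiplier_def)
  have "grad f xs \<bullet> d = 0"
  proof -
    have "d \<bullet> (grad f xs + (\<Sum>j\<in>S. c0 j *\<^sub>R constr_grad g h xs j)) = d \<bullet> grad f xs"
      using zeroS by (simp add: inner_add_right inner_sum_right)
    then show ?thesis by (simp add: stat0 inner_commute)
  qed
  moreover have "(d, 0) \<in> CC_lin_cone m p \<kappa> g h xs ys"
  proof -
    have "grad (g i) xs \<bullet> d \<le> 0" if i: "i \<in> I_g m g xs" for i
    proof -
      have j: "Inl i \<in> ?J" using i by (auto simp: I_g_def constr_index_def)
      have "d \<bullet> constr_grad g h xs (Inl i) \<le> 0"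
      proof (rule LIMSEQ_le_const2[OF dd[OF j]])
        have "constr g h (Inl i) (W k) - constr g h (Inl i) xs \<le> 0" for k
          using i feas[of "r1 (r2 k)"] by (auto simp: constr_def W_def I_g_def feasZ_def)
        then show "\<exists>N. \<forall>n\<ge>N. (constr g h (Inl i) (W n) - constr g h (Inl i) xs) /\<^sub>R norm (W n - xs) \<le> 0"
          by (simp add: mult_nonneg_nonpos)
      qed
      then show ?thesis by (simp add: constr_grad_def inner_commute)
    qed
    moreover have "grad (h i) xs \<bullet> d = 0" if i: "i \<in> {1..p}" for i
    proof -
      have "constr g h (Inr (Inl i)) (W k) = constr g h (Inr (Inl i)) xs" for k
        using i feas[of "r1 (r2 k)"] xs by (auto simp: constr_def W_def feasZ_def)
      then have "d \<bullet> constr_grad g h xs (Inr (Inl i)) = 0"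
        using i by (intro zero) (auto simp: constr_index_def)
      then show ?thesis by (simp add: constr_grad_def inner_commute)
    qed
    moreover have "d $ i = 0" if i: "i \<in> I_01 xs ys \<union> I_0p xs ys" for i
    proof -
      have i': "xs $ i = 0" "0 < ys $ i" using i by (auto simp: I_01_def I_0p_def)
      have "(\<lambda>k. Y (r1 (r2 k)) $ i) \<longlonglongrightarrow> ys $ i"
        using LIMSEQ_subseq_LIMSEQ[OF LIMSEQ_subseq_LIMSEQ[OF Y r1] r2]
        by (intro tendsto_vec_nth) (simp add: o_def)
      then have "\<forall>\<^sub>F k in sequentially. Y (r1 (r2 k)) $ i > 0"
        using i'(2) by (rule order_tendstoD)
      then have "\<forall>\<^sub>F k in sequentially. constr g h (Inr (Inr i)) (W k) = constr g h (Inr (Inr i)) xs"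
      proof (rule eventually_mono)
        fix k assume "Y (r1 (r2 k)) $ i > 0"
        moreover have "X (r1 (r2 k)) $ i * Y (r1 (r2 k)) $ i = 0"
          using feas by (auto simp: feasZ_def)
        ultimately show "constr g h (Inr (Inr i)) (W k) = constr g h (Inr (Inr i)) xs"
          by (simp add: constr_def W_def i')
      qed
      then have "d \<bullet> constr_grad g h xs (Inr (Inr i)) = 0"
        by (intro zero) (auto simp: constr_index_def)
      then show ?thesis by (simp add: constr_grad_def inner_axis)
    qed
    ultimately show ?thesis
      by (simp add: CC_lin_cone_def)
  qed
  ultimately have crit: "(d, 0) \<in> CC_crit_cone m p \<kappa> f g h xs ys"
    by (simp add: CC_crit_cone_def)
  have "d \<bullet> ((hessian f xs + (\<Sum>i=1..m. c0 (Inl i) *\<^sub>R hessian (g i) xs)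
                    + (\<Sum>i=1..p. c0 (Inr (Inl i)) *\<^sub>R hessian (h i) xs)) *v d) > 0"
    using d by (intro sosc[OF crit _ tight_imp_M_multiplier[OF tm0]]) auto
  moreover have "(hessian f xs + (\<Sum>i=1..m. c0 (Inl i) *\<^sub>R hessian (g i) xs)
                    + (\<Sum>i=1..p. c0 (Inr (Inl i)) *\<^sub>R hessian (h i) xs)) *v d
       = hessian f xs *v d + (\<Sum>j\<in>S. c0 j *\<^sub>R (constr_hess g h xs j *v d))"
  proof -
    have lin: "linear (\<lambda>A :: real^'n^'n. A *v d)"
      by (intro linearI) (simp_all add: matrix_vector_mult_add_rdistrib scaleR_matrix_vector_assoc)
    have "(\<Sum>j\<in>S. c0 j *\<^sub>R (constr_hess g h xs j *v d)) = (\<Sum>j\<in>?J. c0 j *\<^sub>R (constr_hess g h xs j *v d))"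
      using sumS[of c0] c0 by simp
    then show ?thesis
      by (simp add: linear_add[OF lin] linear_sum[OF lin] linear_scale[OF lin] sum_constr_index
          constr_hess_def add.assoc)
  qed
  moreover have "d \<bullet> (hessian f xs *v d + (\<Sum>j\<in>S. c0 j *\<^sub>R (constr_hess g h xs j *v d))) = 0"
  proof (rule second_order_limit_zero[OF _ W Wne Wd hessian_has_derivative[OF f], where c = "\<lambda>k. c (r2 k)"])
    show "finite S" using SJ by (rule finite_subset) simp
    show "GDERIV (constr g h j) x :> constr_grad g h x j" if "j \<in> S" for j x
      using GDERIV_constr[of m g p h j x] g h SJ that by blast
    show "((\<lambda>z. constr_grad g h z j) has_derivative (\<lambda>d. constr_hess g h xs j *v d)) (at xs)"
      if "j \<in> S" for j
      using constr_grad_has_derivative[of m g p h j xs] g h SJ that by blast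
    show "(\<lambda>k. c (r2 k) j) \<longlonglongrightarrow> c0 j" for j by (rule limW)
    show "grad f (W k) + (\<Sum>j\<in>S. c (r2 k) j *\<^sub>R constr_grad g h (W k) j) = 0" for k
    proof -
      have "c (r2 k) j = 0" if "j \<notin> S" for j
        using nz that by blast
      then show ?thesis
        using tmW[of k] by (simp add: tight_multiplier_def sumS)
    qed
    show "grad f xs + (\<Sum>j\<in>S. c0 j *\<^sub>R constr_grad g h xs j) = 0" by (rule stat0)
    show "constr g h j (W k) = constr g h j xs" if "j \<in> S" for j k
      using actW act that by simp
  qed
  ultimately show False by simp
qed

theorem theorem3p12:
  fixes f :: "real ^ 'n \<Rightarrow> real"
    and g h :: "nat \<Rightarrow> real ^ 'n \<Rightarrow> real"
    and m p :: nat
    and \<kappa> :: int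
    and xs ys :: "real ^ 'n"
    and N :: "(real ^ 'n) \<times> (real ^ 'n) \<Rightarrow> real"
  assumes "\<kappa> < int CARD('n)"
    and "{x \<in> feasX m p g h. int (l0 x) \<le> \<kappa>} \<noteq> {}"
    and "twice_cont_diff f"
    and "\<And>i. i \<in> {1..m} \<Longrightarrow> twice_cont_diff (g i)"
    and "\<And>i. i \<in> {1..p} \<Longrightarrow> twice_cont_diff (h i)"
    and "M_stationary m p \<kappa> f g h xs ys"
    and "CC_CPLD m p g h xs"
    and "\<And>dx dy lam mu gam.
           (dx, dy) \<in> CC_crit_cone m p \<kappa> f g h xs ys \<Longrightarrow> dx \<noteq> 0 \<Longrightarrow>
           M_multiplier m p f g h xs ys lam mu gam \<Longrightarrow>
           dx \<bullet> ((hessian f xs + (\<Sum>i=1..m. lam i *\<^sub>R hessian (g i) xs)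
                    + (\<Sum>i=1..p. mu i *\<^sub>R hessian (h i) xs)) *v dx) > 0"
    and "is_norm N"
  shows "\<exists>r>0. \<forall>(x, y) \<in> feasZ m p \<kappa> g h.
           N ((x, y) - (xs, ys)) < r \<longrightarrow> M_stationary m p \<kappa> f g h x y \<longrightarrow> x = xs"
proof (rule ccontr)
  assume not_isolated: "\<not> ?thesis"
  have "\<exists>v. N (v - (xs, ys)) < 1 / real (Suc k) \<and>
            M_stationary m p \<kappa> f g h (fst v) (snd v) \<and> fst v \<noteq> xs" for k
  proof -
    have "1 / real (Suc k) > 0" by simp
    then have "\<not> (\<forall>(x, y) \<in> feasZ m p \<kappa> g h. N ((x, y) - (xs, ys)) < 1 / real (Suc k) \<longrightarrow>
                 M_stationary m p \<kappa> f g h x y \<longrightarrow> x = xs)"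
      using not_isolated by blast
    then obtain x y where "N ((x, y) - (xs, ys)) < 1 / real (Suc k)"
        "M_stationary m p \<kappa> f g h x y" "x \<noteq> xs"
      by blast
    then show ?thesis by (intro exI[of _ "(x, y)"]) simp
  qed
  then obtain v where Nv: "\<And>k. N (v k - (xs, ys)) < 1 / real (Suc k)"
    and stat: "\<And>k. M_stationary m p \<kappa> f g h (fst (v k)) (snd (v k))"
    and ne: "\<And>k. fst (v k) \<noteq> xs"
    by metis
  obtain C where C: "C > 0" "\<And>w. C * norm w \<le> N w"
    using is_norm_dominates_norm[OF \<open>is_norm N\<close>] by blast
  have null: "(\<lambda>k. (1 / C) * (1 / real (Suc k))) \<longlonglongrightarrow> 0"
    by (intro tendsto_mult_right_zero LIMSEQ_Suc[OF lim_1_over_n])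
  have le: "norm (v k - (xs, ys)) \<le> (1 / C) * (1 / real (Suc k))" for k
  proof -
    have "C * norm (v k - (xs, ys)) \<le> 1 / real (Suc k)"
      using C(2)[of "v k - (xs, ys)"] Nv[of k] by linarith
    then have "norm (v k - (xs, ys)) * C \<le> 1 / real (Suc k)"
      by (simp only: mult.commute)
    then have "norm (v k - (xs, ys)) \<le> (1 / real (Suc k)) / C"
      by (simp only: pos_le_divide_eq[OF C(1)])
    then show ?thesis by (simp only: times_divide_eq_left mult_1 mult_1_left)
  qed
  have "(\<lambda>k. v k - (xs, ys)) \<longlonglongrightarrow> 0"
  proof (rule Lim_null_comparison[OF always_eventually null], rule allI)
    show "norm (v k - (xs, ys)) \<le> (1 / C) * (1 / real (Suc k))" for k
      by (rule le)
  qed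
  then have v: "v \<longlonglongrightarrow> (xs, ys)"
    by (rule LIM_zero_cancel)
  show False
  proof (rule no_stationary_sequence[OF assms(3-5) _ assms(7,8)])
    show "(xs, ys) \<in> feasZ m p \<kappa> g h"
      using assms(6) by (simp add: M_stationary_def)
    show "(\<lambda>k. fst (v k)) \<longlonglongrightarrow> xs" "(\<lambda>k. snd (v k)) \<longlonglongrightarrow> ys"
      using tendsto_fst[OF v] tendsto_snd[OF v] by simp_all
  qed (use ne stat in auto)
qed

end
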